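(* There is a function $\varepsilon:\mathbb{Z}^+\to\mathbb{R}$ with $\varepsilon(n)\to 0$ as $n\to\infty$ such that for every $n\in\mathbb{Z}^+$ there exists a positive integer $k \leq 2^{2^{2n \lg(n) (1 + \varepsilon(n))}}$ with $\#I(k) \geq n$. (In the paper's notation: $k \leq 2^{2^{2n \lg(n) (1 + o(1))}}$.)
   Context: For a prime $p$ and $c\in\mathbb{Z}^+$, let $I_{p,c}=\{p^c, p^c+1,\dots,p^c+p^{c-1}-1\}$. For a positive integer $k$, $\#I(k)$ denotes the number of pairs $(p,c)$ with $p$ prime, $c\in\mathbb{Z}^+$, and $k\in I_{p,c}$. $\lg$ denotes $\log_2$. *)

theory Defs
  imports Complex_Main "HOL-Computational_Algebra.Primes"
begin

(* Truncated subtraction is harmless: only p >= 2 and c >= 1 are used. *)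
definition I_interval :: "nat \<Rightarrow> nat \<Rightarrow> nat set" where
  "I_interval p c = {p ^ c .. p ^ c + p ^ (c - 1) - 1}"

definition I_pairs :: "nat \<Rightarrow> (nat \<times> nat) set" where
  "I_pairs k = {(p, c). prime p \<and> 1 \<le> c \<and> k \<in> I_interval p c}"

definition num_I :: "nat \<Rightarrow> nat" where
  "num_I k = card (I_pairs k)"

(* Hence the cardinality in num_I is a genuine count. *)
lemma finite_I_pairs: "finite (I_pairs k)"
proof (rule finite_subset)
  show "I_pairs k \<subseteq> {..k} \<times> {..k}"
  proof (clarsimp simp: I_pairs_def I_interval_def)
    fix p c :: nat
    assume p: "prime p" and c: "Suc 0 \<le> c" and le: "p ^ c \<le> k"
    have p2: "2 \<le> p" using p by (rule prime_ge_2_nat)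
    have "p \<le> p ^ c" using p2 c by (intro self_le_power) auto
    moreover have "c < p ^ c" using p2 by (intro power_gt_expt) auto
    ultimately show "p \<le> k \<and> c \<le> k" using le by linarith
  qed
qed simp

end

theory Submission
  imports Defs "HOL-Analysis.Kronecker_Approximation_Theorem" "HOL-Number_Theory.Prime_Powers"
    "HOL-Real_Asymp.Real_Asymp"
begin

text \<open>
  Writing \<open>y = ln z\<close>, the interval of \<open>(p, c)\<close> contains \<open>z\<close> iff
  \<open>0 \<le> y - c ln p < ln (1 + 1/p)\<close>. Dirichlet's simultaneous approximation gives an \<open>x\<close> that is
  within \<open>ln P / N\<close> of a multiple of \<open>ln p\<close> for each of \<open>n\<close> primes \<open>p \<le> P\<close>; the shift
  \<open>y = x + ln P / N\<close> makes all the errors nonnegative at once, so they are admissible as soon as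
  \<open>2 ln P / N \<le> 1 / (P + 1)\<close>. The interval endpoints being integers, \<open>\<lfloor>exp y\<rfloor>\<close> also lies in
  every interval. Since \<open>y\<close> is about \<open>N ^ n\<close>, it remains to find \<open>n\<close> primes below a \<open>P\<close> that is
  a small power of \<open>n\<close>, for which Chebyshev's lower bound suffices.
\<close>

section \<open>Chebyshev's lower bound for the number of primes\<close>

text \<open>Write each \<open>ln m\<close> as the sum of \<open>mangoldt\<close> over the divisors
  of \<open>m\<close> and swap the sums: exactly \<open>n div d\<close> multiples of
  \<open>d\<close> lie in \<open>{1..n}\<close>.\<close>

lemma ln_fact_eq_sum_mangoldt:
  "ln (fact n :: real) = (\<Sum>d\<in>{1..n}. mangoldt d * real (n div d))"
proof -
  have "ln (fact n :: real) = (\<Sum>m\<in>{1..n}. ln (real m))"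
    unfolding fact_prod of_nat_prod by (rule ln_prod) auto
  also have "\<dots> = (\<Sum>m\<in>{1..n}. \<Sum>d | d dvd m. mangoldt d)"
    by (intro sum.cong refl, subst mangoldt_sum) auto
  also have "\<dots> = (\<Sum>m\<in>{1..n}. \<Sum>d\<in>{d\<in>{1..n}. d dvd m}. mangoldt d)"
  proof (intro sum.cong refl)
    fix m assume "m \<in> {1..n}"
    hence "0 < m" "m \<le> n" by auto
    then show "{d. d dvd m} = {d\<in>{1..n}. d dvd m}"
      by (auto dest: dvd_imp_le intro: Nat.gr0I simp: Suc_le_eq)
  qed
  also have "\<dots> = (\<Sum>d\<in>{1..n}. \<Sum>m\<in>{m\<in>{1..n}. d dvd m}. mangoldt d)"
    by (rule sum.swap_restrict) auto
  also have "\<dots> = (\<Sum>d\<in>{1..n}. mangoldt d * real (n div d))"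
  proof (intro sum.cong refl)
    fix d assume d: "d \<in> {1..n}"
    have "{m\<in>{1..n}. d dvd m} = (\<lambda>j. d * j) ` {1..n div d}"
    proof (intro equalityI subsetI)
      fix m assume "m \<in> {m\<in>{1..n}. d dvd m}"
      then obtain j where "m = d * j" "1 \<le> m" "m \<le> n" by auto
      with d show "m \<in> (\<lambda>j. d * j) ` {1..n div d}"
        by (auto simp: less_eq_div_iff_mult_less_eq mult.commute Suc_le_eq)
    next
      fix m assume "m \<in> (\<lambda>j. d * j) ` {1..n div d}"
      with d show "m \<in> {m\<in>{1..n}. d dvd m}"
        by (auto simp: less_eq_div_iff_mult_less_eq mult.commute Suc_le_eq)
    qed
    moreover have "inj_on (\<lambda>j. d * j) {1..n div d}"
      using d by (auto simp: inj_on_def)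
    ultimately show "(\<Sum>m\<in>{m\<in>{1..n}. d dvd m}. mangoldt d) = mangoldt d * real (n div d)"
      by (simp add: card_image)
  qed
  finally show ?thesis .
qed

text \<open>In the logarithm of (2m)!/(m!)^2, \<open>mangoldt d\<close> has coefficient
  \<open>2 * m div d - 2 * (m div d)\<close>, which is at most 1.\<close>

lemma ln_central_binomial_le_sum_mangoldt:
  "ln (real (2 * m choose m)) \<le> (\<Sum>d\<in>{1..2 * m}. mangoldt d)"
proof -
  have "real (2 * m choose m) = fact (2 * m) / (fact m * fact m)"
    by (simp add: binomial_fact mult_2)
  hence "ln (real (2 * m choose m)) = ln (fact (2 * m)) - 2 * ln (fact m :: real)"
    by (simp add: ln_div ln_mult)
  \<comment> \<open>The sum may run up to \<open>2 * m\<close> because \<open>m div d = 0\<close>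
    for \<open>d > m\<close>; both factorials then share one index set.\<close>
  also have "ln (fact m :: real) = (\<Sum>d\<in>{1..2 * m}. mangoldt d * real (m div d))"
    unfolding ln_fact_eq_sum_mangoldt by (rule sum.mono_neutral_left) auto
  also have "ln (fact (2 * m)) - 2 * (\<Sum>d\<in>{1..2 * m}. mangoldt d * real (m div d)) =
      (\<Sum>d\<in>{1..2 * m}. mangoldt d * (real (2 * m div d) - 2 * real (m div d)))"
    unfolding ln_fact_eq_sum_mangoldt
    by (simp add: sum_distrib_left sum_subtractf algebra_simps)
  also have "\<dots> \<le> (\<Sum>d\<in>{1..2 * m}. mangoldt d * 1)"
  proof (intro sum_mono mult_left_mono mangoldt_nonneg)
    fix d assume "d \<in> {1..2 * m}"
    hence d: "d > 0" by auto
    have "2 * m < 2 * (d * (m div d)) + 2 * d"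
      using mult_div_mod_eq[of d m] mod_less_divisor[OF d, of m] by linarith
    also have "\<dots> = d * (2 * (m div d) + 2)" by (simp add: algebra_simps)
    finally have "2 * m div d < 2 * (m div d) + 2"
      using d by (simp add: div_less_iff_less_mult mult.commute)
    thus "real (2 * m div d) - 2 * real (m div d) \<le> 1" by linarith
  qed
  finally show ?thesis by simp
qed

text \<open>Group the prime powers by their prime: \<open>p\<close> contributes \<open>ln p\<close>
  for each of its powers up to \<open>M\<close>. There are at most \<open>log p M\<close> of them,
  so each prime contributes at most \<open>ln M\<close>.\<close>

lemma sum_mangoldt_le_card_primes:
  assumes "M > 0"
  shows "(\<Sum>d\<in>{1..M}. mangoldt d :: real) \<le> real (card {p. prime p \<and> p \<le> M}) * ln (real M)"
proof -
  let ?Q = "{d\<in>{1..M}. primepow d}" and ?P = "{p. prime p \<and> p \<le> M}"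
  have fin: "finite ?P" by (rule finite_subset[of _ "{..M}"]) auto
  have "(\<Sum>d\<in>{1..M}. mangoldt d :: real) = (\<Sum>d\<in>?Q. ln (real (aprimedivisor d)))"
    by (intro sum.mono_neutral_cong_right) (auto simp: mangoldt_def)
  also have "\<dots> = (\<Sum>p\<in>?P. \<Sum>d\<in>{d\<in>?Q. aprimedivisor d = p}. ln (real (aprimedivisor d)))"
  proof (rule sum.group[symmetric])
    show "aprimedivisor ` ?Q \<subseteq> ?P"
    proof clarsimp
      fix d assume "Suc 0 \<le> d" "d \<le> M" "primepow d"
      hence "d \<noteq> 1" "d > 0" by auto
      hence "prime (aprimedivisor d)" "aprimedivisor d \<le> d"
        by (auto intro!: prime_aprimedivisor' dvd_imp_le aprimedivisor_dvd')
      with \<open>d \<le> M\<close> show "prime (aprimedivisor d) \<and> aprimedivisor d \<le> M" by linarith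
    qed
  qed (use fin in auto)
  also have "\<dots> \<le> (\<Sum>p\<in>?P. ln (real M))"
  proof (rule sum_mono)
    fix p assume "p \<in> ?P"
    hence p: "prime p" by auto
    hence p2: "p \<ge> 2" by (rule prime_ge_2_nat)
    define K where "K = nat \<lfloor>log p M\<rfloor>"
    have "{d\<in>?Q. aprimedivisor d = p} \<subseteq> (\<lambda>k. p ^ k) ` {1..K}"
    proof
      fix d assume d: "d \<in> {d\<in>?Q. aprimedivisor d = p}"
      then obtain q k where qk: "prime q" "k > 0" "d = q ^ k"
        by (auto simp: primepow_def)
      with d have "q = p" by (auto simp: aprimedivisor_prime_power)
      with qk d have "real (p ^ k) \<le> real M" unfolding of_nat_le_iff by auto
      hence "real k \<le> log p M"
        using p2 by (intro le_log_of_power) auto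
      hence "k \<le> K" unfolding K_def by linarith
      with qk \<open>q = p\<close> show "d \<in> (\<lambda>k. p ^ k) ` {1..K}" by auto
    qed
    hence "card {d\<in>?Q. aprimedivisor d = p} \<le> card {1..K}"
      by (metis card_image_le card_mono finite_atLeastAtMost finite_imageI le_trans)
    \<comment> \<open>Without the sign, truncation by \<open>nat\<close> could make \<open>K\<close>
      exceed the logarithm.\<close>
    moreover have "0 \<le> log p M" using p2 assms by (simp add: Suc_le_eq)
    ultimately have "real (card {d\<in>?Q. aprimedivisor d = p}) \<le> log p M"
      unfolding K_def by simp linarith
    hence "real (card {d\<in>?Q. aprimedivisor d = p}) * ln p \<le> log p M * ln p"
      using p2 by (intro mult_right_mono) auto
    also have "log p M * ln p = ln M" using p2 by (simp add: log_def)
    finally show "(\<Sum>d\<in>{d\<in>?Q. aprimedivisor d = p}. ln (real (aprimedivisor d))) \<le> ln (real M)"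
      by simp
  qed
  finally show ?thesis by simp
qed

text \<open>Combine the two preceding bounds with \<open>4 ^ m / (2 * m)\<close> as a lower bound
  for the central binomial coefficient. The denominator \<open>2 * m\<close> accounts for the
  \<open>+ 1\<close>.\<close>

lemma card_primes_lower_bound:
  assumes "m > 0"
  shows "2 * real m * ln 2 \<le> (real (card {p. prime p \<and> p \<le> 2 * m}) + 1) * ln (real (2 * m))"
proof -
  have "ln (4 ^ m / (2 * real m)) \<le> ln (real (2 * m choose m))"
    using central_binomial_lower_bound[OF assms] assms by (intro ln_mono) auto
  also have "\<dots> \<le> real (card {p. prime p \<and> p \<le> 2 * m}) * ln (real (2 * m))"
    using ln_central_binomial_le_sum_mangoldt[of m] sum_mangoldt_le_card_primes[of "2 * m"] assms
    by simp
  also have "ln (4 ^ m / (2 * real m)) = 2 * real m * ln 2 - ln (real (2 * m))"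
    using assms ln_realpow[of 2 2] by (simp add: ln_div ln_realpow)
  finally show ?thesis by (simp add: algebra_simps)
qed

section \<open>From simultaneous approximation to many intervals\<close>

text \<open>Both \<open>p ^ c\<close> and \<open>p ^ c * (1 + 1 / p) = p ^ c + p ^ (c - 1)\<close>
  are integers, so rounding \<open>z\<close> down keeps it in each interval. Distinct primes give
  distinct pairs.\<close>

lemma num_I_ge_if_real_in_intervals:
  assumes "finite S" "\<And>p. p \<in> S \<Longrightarrow> prime p"
    and "\<And>p. p \<in> S \<Longrightarrow> 1 \<le> c p \<and> real p ^ c p \<le> z \<and> z < real p ^ c p * (1 + 1 / real p)"
  shows "card S \<le> num_I (nat \<lfloor>z\<rfloor>)"
proof -
  have "(\<lambda>p. (p, c p)) ` S \<subseteq> I_pairs (nat \<lfloor>z\<rfloor>)"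
  proof clarify
    fix p assume p: "p \<in> S"
    have pr: "prime p" and c: "1 \<le> c p" and le: "real (p ^ c p) \<le> z"
      and less: "z < real p ^ c p * (1 + 1 / real p)"
      using assms p by auto
    have p0: "p > 0" using pr by (simp add: prime_gt_0_nat)
    have "real p ^ c p * (1 + 1 / real p) = real (p ^ c p + p ^ (c p - 1))"
      using c p0 by (cases "c p") (auto simp: field_simps)
    with less have "nat \<lfloor>z\<rfloor> < p ^ c p + p ^ (c p - 1)" using le by linarith
    moreover have "p ^ c p \<le> nat \<lfloor>z\<rfloor>" using le by linarith
    ultimately show "(p, c p) \<in> I_pairs (nat \<lfloor>z\<rfloor>)"
      using pr c by (auto simp: I_pairs_def I_interval_def)
  qed
  hence "card ((\<lambda>p. (p, c p)) ` S) \<le> card (I_pairs (nat \<lfloor>z\<rfloor>))"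
    by (intro card_mono finite_I_pairs)
  thus ?thesis by (simp add: card_image inj_on_def num_I_def)
qed

lemma exists_num_I_ge:
  fixes P N n :: nat
  assumes P: "P \<ge> 2" and card: "n \<le> card {p. prime p \<and> p \<le> P}"
    and N: "2 * (real P + 1) * ln (real P) \<le> real N"
  obtains k where "1 \<le> k" "real k \<le> exp (ln (real P) * (real N ^ n + 1))" "n \<le> num_I k"
proof -
  have lnP: "ln (real P) > 0" using P by simp
  have "0 < 2 * (real P + 1) * ln (real P)" using lnP by simp
  hence N0: "N > 0" using N by linarith
  obtain S where S: "S \<subseteq> {p. prime p \<and> p \<le> P}" "card S = n" "finite S"
    using card obtain_subset_with_card_n by metis
  obtain f where f: "bij_betw f {..<n} S"
    using S ex_bij_betw_nat_finite[of S] by (auto simp: atLeast0LessThan)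
  \<comment> \<open>The factor \<open>ln P\<close> in the approximated ratios makes each of them at
    least 1, which keeps the exponents \<open>a i\<close> positive. Multiplying by
    \<open>ln p\<close> later gives an error below \<open>ln p / N\<close>, hence below
    \<open>ln P / N\<close>.\<close>
  obtain q a where q: "0 < q" "q \<le> int (N ^ n)"
    and a: "\<And>i. i < n \<Longrightarrow> \<bar>of_int q * (ln P / ln (f i)) - of_int (a i)\<bar> < 1 / N"
    using Dirichlet_approx_simult[OF N0, of n "\<lambda>i. ln P / ln (f i)"] by metis
  define y where "y = of_int q * ln P + ln P / N"
  have y0: "y \<ge> 0" using q lnP N0 by (auto simp: y_def)
  have "\<exists>c. 1 \<le> c \<and> real p ^ c \<le> exp y \<and> exp y < real p ^ c * (1 + 1 / real p)"
    if p: "p \<in> S" for p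
  proof -
    obtain i where i: "i < n" "p = f i"
      using p f by (auto simp: bij_betw_def)
    have p2: "p \<ge> 2" and pP: "p \<le> P"
      using p S by (auto simp: prime_ge_2_nat)
    have lnp: "ln p > 0" "ln p \<le> ln P" using p2 pP by auto
    have "1 \<le> of_int q * (ln P / ln p)"
      using q lnp mult_mono[of 1 "of_int q" 1 "ln P / ln p"] by auto
    moreover have "1 / real N \<le> 1" using N0 by auto
    ultimately have "real_of_int (a i) > 0" using a[OF i(1), folded i(2)] by linarith
    hence a0: "a i > 0" by simp
    define c where "c = nat (a i)"
    have c: "c \<ge> 1" "real_of_int (a i) = real c" using a0 by (auto simp: c_def)
    have "\<bar>of_int q * ln P - real c * ln p\<bar> = \<bar>of_int q * (ln P / ln p) - real c\<bar> * ln p"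
      using lnp by (simp add: abs_mult_pos' [symmetric] field_simps)
    also have "\<dots> < 1 / N * ln p"
      using a[OF i(1)] i c lnp by (intro mult_strict_right_mono) auto
    also have "\<dots> \<le> ln P / N" using lnp N0 by (simp add: field_simps)
    finally have *: "\<bar>of_int q * ln P - real c * ln p\<bar> < ln P / N" .
    have "y < real c * ln p + 2 * ln P / N" using * by (simp add: y_def)
    also have "2 * ln P / N \<le> 1 / (1 + real P)"
      using N N0 by (simp add: field_simps)
    also have "\<dots> \<le> 1 / (1 + real p)" using pP by (simp add: frac_le)
    \<comment> \<open>This form prepares \<open>ln t \<le> t - 1\<close> at
      \<open>t = 1 / (1 + 1 / p)\<close>, which bounds \<open>ln (1 + 1 / p)\<close> from
      below.\<close>
    also have "\<dots> = - (1 / (1 + 1 / real p) - 1)" using p2 by (simp add: field_simps)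
    also have "\<dots> \<le> - ln (1 / (1 + 1 / real p))"
      using ln_le_minus_one[of "1 / (1 + 1 / real p)"] p2 by (simp add: add_pos_pos)
    also have "\<dots> = ln (1 + 1 / real p)" using p2 by (subst ln_div) (auto simp: add_pos_pos)
    finally have "exp y < exp (real c * ln p + ln (1 + 1 / real p))" by simp
    also have "\<dots> = real p ^ c * (1 + 1 / real p)"
      using p2 by (simp add: exp_add exp_of_nat_mult add_pos_pos)
    finally have "exp y < real p ^ c * (1 + 1 / real p)" .
    moreover have "exp (real c * ln p) \<le> exp y" using * by (simp add: y_def)
    hence "real p ^ c \<le> exp y" using p2 by (simp add: exp_of_nat_mult)
    ultimately show ?thesis using c by blast
  qed
  then obtain c where
    c: "\<And>p. p \<in> S \<Longrightarrow> 1 \<le> c p \<and> real p ^ c p \<le> exp y \<and> exp y < real p ^ c p * (1 + 1 / real p)"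
    by metis
  have "n \<le> num_I (nat \<lfloor>exp y\<rfloor>)"
    using num_I_ge_if_real_in_intervals[of S c "exp y"] S c by auto
  moreover have "1 \<le> exp y" using y0 by simp
  hence "1 \<le> nat \<lfloor>exp y\<rfloor>" by linarith
  moreover have "real (nat \<lfloor>exp y\<rfloor>) \<le> exp y" by simp
  moreover have "y \<le> ln P * (real N ^ n + 1)"
  proof -
    have "of_int q \<le> real_of_int (int (N ^ n))" using q(2) by (simp only: of_int_le_iff)
    hence "of_int q * ln P \<le> real N ^ n * ln P"
      using lnP by (intro mult_right_mono) auto
    moreover have "ln P / N \<le> ln P" using lnP N0 by (simp add: field_simps)
    ultimately show ?thesis by (simp add: y_def algebra_simps)
  qed
  hence "exp y \<le> exp (ln P * (real N ^ n + 1))" by simp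
  ultimately show ?thesis using that by (meson order_trans)
qed

section \<open>Choice of the parameters\<close>

text \<open>
  The exponents 3/2 and 7/4 leave room for logarithms in
  \<open>n log P \<lless> P \<lless> P log P \<lless> N\<close>, while \<open>N ^ n\<close> stays far below \<open>n ^ (2 n)\<close>.
\<close>
lemma eventually_exists_num_I_ge:
  "eventually (\<lambda>n. \<exists>k. 1 \<le> k \<and>
     real k \<le> 2 powr (2 powr (2 * real n * log 2 (real n))) \<and> n \<le> num_I k) sequentially"
proof -
  \<comment> \<open>With \<open>P = 2 * m\<close>, the three estimates yield enough primes up to
    \<open>P\<close>, the condition on \<open>N\<close>, and the bound on \<open>k\<close>. The
    \<open>- 1\<close> in \<open>A\<close> and the \<open>+ 1\<close> after the power 7/4 in
    \<open>C\<close> allow for rounding to \<open>m\<close> and \<open>N\<close>.\<close>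
  have A: "eventually (\<lambda>n::nat. (real n + 1) * ln (2 * real n powr (3/2)) \<le>
      2 * (real n powr (3/2) - 1) * ln 2) sequentially"
    by real_asymp
  have B: "eventually (\<lambda>n::nat. 2 * (2 * real n powr (3/2) + 1) * ln (2 * real n powr (3/2))
      \<le> real n powr (7/4)) sequentially"
    by real_asymp
  have C: "eventually (\<lambda>n::nat. ln (2 * real n powr (3/2)) * ((real n powr (7/4) + 1) powr real n + 1)
      \<le> ln 2 * (real n powr (2 * real n))) sequentially"
    by real_asymp
  show ?thesis
    using A B C eventually_ge_at_top[of 2]
  proof eventually_elim
    case (elim n)
    define r where "r = real n powr (3/2)"
    define m where "m = nat \<lfloor>r\<rfloor>"
    define N where "N = nat \<lceil>real n powr (7/4)\<rceil>"
    have "real n powr 1 \<le> r" unfolding r_def using elim by (intro powr_mono) auto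
    hence r2: "r \<ge> 2" using elim by simp
    hence m: "m \<ge> 2" "real m \<le> r" "r - 1 \<le> real m" unfolding m_def by linarith+
    have ln_le: "ln (real (2 * m)) \<le> ln (2 * r)" using m by simp
    have lnp: "ln (real (2 * m)) > 0" using m by simp
    have "(real n + 1) * ln (real (2 * m)) \<le> (real n + 1) * ln (2 * r)"
      using ln_le by (intro mult_left_mono) auto
    also have "\<dots> \<le> 2 * (r - 1) * ln 2" using elim by (simp add: r_def)
    also have "\<dots> \<le> 2 * real m * ln 2" using m by simp
    also have "\<dots> \<le> (real (card {p. prime p \<and> p \<le> 2 * m}) + 1) * ln (real (2 * m))"
      using m by (intro card_primes_lower_bound) auto
    finally have card: "n \<le> card {p. prime p \<and> p \<le> 2 * m}"
      using lnp by (simp add: mult_le_cancel_right)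
    have "2 * (real (2 * m) + 1) * ln (real (2 * m)) \<le> 2 * (2 * r + 1) * ln (2 * r)"
      using m lnp ln_le r2 by (intro mult_mono) auto
    also have "\<dots> \<le> real N" using elim unfolding N_def r_def by linarith
    finally obtain k where k: "1 \<le> k" "n \<le> num_I k"
      and k_le: "real k \<le> exp (ln (real (2 * m)) * (real N ^ n + 1))"
      using exists_num_I_ge[of "2 * m" n N] card m by auto
    have "real N \<le> real n powr (7/4) + 1"
      unfolding N_def using powr_ge_zero[of "real n" "7/4"] by linarith
    hence "real N ^ n \<le> (real n powr (7/4) + 1) ^ n" by (intro power_mono) auto
    also have "\<dots> = (real n powr (7/4) + 1) powr real n"
      by (rule powr_realpow[symmetric]) (simp add: add_nonneg_pos)
    finally have "ln (real (2 * m)) * (real N ^ n + 1) \<le>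
        ln (2 * r) * ((real n powr (7/4) + 1) powr real n + 1)"
      using ln_le lnp r2 by (intro mult_mono) auto
    also have "\<dots> \<le> ln 2 * real n powr (2 * real n)" using elim by (simp add: r_def)
    also have "real n powr (2 * real n) = (2 powr log 2 (real n)) powr (2 * real n)"
      using elim by simp
    also have "\<dots> = 2 powr (2 * real n * log 2 (real n))"
      unfolding powr_powr by (simp add: mult_ac)
    finally have "exp (ln (real (2 * m)) * (real N ^ n + 1)) \<le>
        2 powr (2 powr (2 * real n * log 2 (real n)))"
      by (simp add: powr_def mult_ac)
    with k k_le show ?case by (meson order_trans)
  qed
qed

section \<open>The finitely many small values of n\<close>

text \<open>The bound holds with \<open>\<epsilon> n = 0\<close> from some \<open>n0\<close> on, so
  the limit is 0 whatever finite values are taken below \<open>n0\<close>.\<close>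

theorem mainTheorem2:
  shows "\<exists>\<epsilon> :: nat \<Rightarrow> real. \<epsilon> \<longlonglongrightarrow> 0 \<and>
    (\<forall>n :: nat. 1 \<le> n \<longrightarrow>
      (\<exists>k :: nat. 1 \<le> k \<and>
        real k \<le> 2 powr (2 powr (2 * real n * log 2 (real n) * (1 + \<epsilon> n))) \<and>
        n \<le> num_I k))"
proof -
  let ?good = "\<lambda>n e. \<exists>k :: nat. 1 \<le> k \<and>
    real k \<le> 2 powr (2 powr (2 * real n * log 2 (real n) * (1 + e))) \<and> n \<le> num_I k"
  obtain n0 where n0: "\<And>n. n \<ge> n0 \<Longrightarrow> ?good n 0"
    using eventually_exists_num_I_ge by (auto simp: eventually_sequentially)
  have "\<exists>e. ?good n e \<and> (n \<ge> n0 \<longrightarrow> e = 0)" if "n \<ge> 1" for n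
  proof -
    have "n \<ge> n0 \<or> n = 1 \<or> (2 \<le> n \<and> n < n0)" using that by linarith
    then consider "n \<ge> n0" | "n = 1" | "2 \<le> n" "n < n0" by blast
    thus ?thesis
    proof cases
      case 1
      then show ?thesis using n0 by blast
    next
      case 2
      \<comment> \<open>Since \<open>log 2 1 = 0\<close>, the bound for \<open>n = 1\<close> is 2
        whatever \<open>\<epsilon>\<close> is; \<open>k = 2\<close> attains it.\<close>
      have "(2, 1) \<in> I_pairs 2" by (simp add: I_pairs_def I_interval_def)
      hence "card {(2, 1) :: nat \<times> nat} \<le> num_I 2"
        unfolding num_I_def by (intro card_mono finite_I_pairs) auto
      hence "?good n 0" using 2 by (intro exI[of _ 2]) auto
      thus ?thesis by blast
    next
      case 3
      \<comment> \<open>A \<open>k\<close> that serves \<open>n0\<close> also serves every smaller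
        \<open>n\<close>. Taking \<open>\<epsilon> n = k\<close> makes the bound large enough, by
        \<open>k < 2 powr k\<close> used twice and \<open>2 * n * log 2 n \<ge> 1\<close>.\<close>
      obtain k where k: "1 \<le> k" "n0 \<le> num_I k" using n0[of n0] by blast
      have less: "real k < 2 powr real k"
        using of_nat_less_two_power[of k, where ?'a = real] by (simp add: powr_realpow)
      have "1 \<le> log 2 (real n)" using 3 by simp
      hence "1 * 1 \<le> (2 * real n) * log 2 (real n)" using 3 by (intro mult_mono) auto
      hence "1 * real k \<le> (2 * real n * log 2 (real n)) * (1 + real k)"
        by (intro mult_mono) auto
      hence "2 powr real k \<le> 2 powr ((2 * real n * log 2 (real n)) * (1 + real k))"
        (is "_ \<le> ?E") by simp
      hence "real k \<le> ?E" using less by linarith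
      hence "2 powr real k \<le> 2 powr ?E" by (intro powr_mono) auto
      hence "real k \<le> 2 powr ?E" using less by linarith
      with k 3 have "?good n (real k)" by (intro exI[of _ k]) auto
      thus ?thesis using 3 by auto
    qed
  qed
  then obtain \<epsilon> where \<epsilon>: "\<And>n. n \<ge> 1 \<Longrightarrow> ?good n (\<epsilon> n) \<and> (n \<ge> n0 \<longrightarrow> \<epsilon> n = 0)"
    by metis
  have "eventually (\<lambda>n. \<epsilon> n = 0) sequentially"
    using eventually_ge_at_top[of "max 1 n0"] by eventually_elim (use \<epsilon> in auto)
  hence "\<epsilon> \<longlonglongrightarrow> 0" by (rule tendsto_eventually)
  with \<epsilon> show ?thesis by blast
qed

end
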